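(* Let $y \sim \mathcal{N}(\mu, \sigma^2 I)$ be an $n$-dimensional Gaussian random variable with mean $\mu \in \mathbb{R}^n$ and $\sigma^2 > 0$. Let $E \subseteq \mathbb{R}^n$ be a closed set and let $\hat{\mu} : E^c \to \mathbb{R}^n$ be continuously differentiable, regarded as an estimator $\hat\mu = \hat\mu(y)$ of $\mu$ with finite second moment, $E\|\hat{\mu}\|_2^2 < \infty$ (expectation with respect to the distribution of $y$). Suppose that $\mathcal{H}^{n-1}(E) = 0$, and that either $$\sum_{i=1}^n E\left|\partial_i \hat{\mu}_i\right| < \infty$$ or $\nabla \cdot \hat{\mu} \geq 0$ Lebesgue almost everywhere. Then $$\frac{1}{\sigma^2} \sum_{i=1}^n \mathrm{cov}(\hat{\mu}_i, y_i) = \sum_{i=1}^n E\left(\partial_i \hat{\mu}_i\right) = E\left(\nabla \cdot \hat{\mu}\right).$$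
   Context: $\mathcal{H}^{n-1}$ denotes the $(n-1)$-dimensional Hausdorff measure on $\mathbb{R}^n$, and $E^c = \mathbb{R}^n \setminus E$. The divergence of $\hat\mu = (\hat\mu_1,\ldots,\hat\mu_n)$ is $\nabla \cdot \hat{\mu} = \sum_{i=1}^n \partial_i \hat{\mu}_i$, where $\partial_i$ is the partial derivative with respect to the $i$-th coordinate; it is defined on $E^c$. The symbol $E$ denotes the closed set when it stands alone as a set, and expectation under the distribution of $y$ when applied to a random quantity. Expectations and covariances involve $\hat\mu(y)$ and its partial derivatives evaluated at the random point $y$, with values on the exceptional set $E$ (a null set) being irrelevant.
   Formalization: In the alternative where the divergence is nonnegative a.e., it is also assumed that each expectation of ∂_i μ̂_i exists in [-∞,∞]; without this the middle term may be undefined and the identity can fail (log potential of a Cantor measure in the plane). *)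

theory Defs
  imports "HOL-Probability.Probability"
begin

text \<open>
  Outer Hausdorff measure of integer dimension, with the normalisation that makes it agree with
  Lebesgue measure in full dimension. The empty set is treated separately because
  \<open>0 ^ 0 = 1\<close>: for \<open>k = 0\<close> every nonempty covering set counts \<open>1\<close>, and \<open>{}\<close>
  counts \<open>0\<close>. Boundedness is required because the value of \<open>diameter\<close> is unspecified
  on unbounded sets.
\<close>

definition hausdorff_gauge :: "nat \<Rightarrow> 'a::metric_space set \<Rightarrow> ennreal" where
  "hausdorff_gauge k U =
     (if U = {} then 0 else ennreal (unit_ball_vol (real k) * (diameter U / 2) ^ k))"

definition hausdorff_premeasure :: "nat \<Rightarrow> real \<Rightarrow> 'a::metric_space set \<Rightarrow> ennreal" where
  "hausdorff_premeasure k \<delta> A =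
     Inf {(\<Sum>j. hausdorff_gauge k (U j)) | U :: nat \<Rightarrow> 'a set.
            A \<subseteq> (\<Union>j. U j) \<and> (\<forall>j. bounded (U j) \<and> diameter (U j) \<le> \<delta>)}"

definition hausdorff_measure :: "nat \<Rightarrow> 'a::metric_space set \<Rightarrow> ennreal" where
  "hausdorff_measure k A = (SUP \<delta>\<in>{0<..}. hausdorff_premeasure k \<delta> A)"

text \<open>Density of the law \<open>N(\<mu>, \<sigma>\<^sup>2 I)\<close>; \<open>\<sigma>\<close> is the standard deviation.\<close>

definition isotropic_normal_density :: "real^'n \<Rightarrow> real \<Rightarrow> real^'n \<Rightarrow> real" where
  "isotropic_normal_density \<mu> \<sigma> x = (\<Prod>i\<in>UNIV. normal_density (\<mu> $ i) \<sigma> (x $ i))"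

definition covariance :: "'a measure \<Rightarrow> ('a \<Rightarrow> real) \<Rightarrow> ('a \<Rightarrow> real) \<Rightarrow> real" where
  "covariance M X Y =
     (\<integral>\<omega>. (X \<omega> - (\<integral>\<omega>'. X \<omega>' \<partial>M)) * (Y \<omega> - (\<integral>\<omega>'. Y \<omega>' \<partial>M)) \<partial>M)"

text \<open>
  The expectation of \<open>X\<close> exists in \<open>[-\<infinity>, \<infinity>]\<close>: the positive and the negative part do not both
  have infinite expectation (\<open>ennreal\<close> truncates negative reals to \<open>0\<close>). Finiteness is not
  part of the predicate. A nonnegative divergence alone does not make the expectations of the
  individual partial derivatives exist: for the gradient of the logarithmic potential of the Cantor
  measure on a Cantor set \<open>E\<close> in a line of the plane, the divergence is \<open>0\<close> off
  \<open>E\<close>, these expectations do not exist, and Stein's identity fails.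
\<close>

definition expectation_exists :: "'a measure \<Rightarrow> ('a \<Rightarrow> real) \<Rightarrow> bool" where
  "expectation_exists M X \<longleftrightarrow>
     X \<in> borel_measurable M \<and>
     ((\<integral>\<^sup>+\<omega>. ennreal (X \<omega>) \<partial>M) < \<infinity> \<or> (\<integral>\<^sup>+\<omega>. ennreal (- X \<omega>) \<partial>M) < \<infinity>)"

text \<open>Meant for open \<open>S\<close>, as the derivative is two-sided.\<close>

definition continuously_differentiable_on ::
    "('a::real_normed_vector \<Rightarrow> 'b::real_normed_vector) \<Rightarrow> 'a set \<Rightarrow> bool" where
  "continuously_differentiable_on f S \<longleftrightarrow>
     (\<exists>f' :: 'a \<Rightarrow> 'a \<Rightarrow>\<^sub>L 'b.
        (\<forall>x\<in>S. (f has_derivative blinfun_apply (f' x)) (at x)) \<and> continuous_on S f')"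

definition partial_deriv :: "'n \<Rightarrow> (real^'n \<Rightarrow> real) \<Rightarrow> real^'n \<Rightarrow> real" where
  "partial_deriv i f x = deriv (\<lambda>t. f (x + t *\<^sub>R axis i 1)) 0"

definition divergence :: "(real^'n \<Rightarrow> real^'n) \<Rightarrow> real^'n \<Rightarrow> real" where
  "divergence f x = (\<Sum>i\<in>UNIV. partial_deriv i (\<lambda>z. f z $ i) x)"

text \<open>
  A function given only on the complement of \<open>E\<close> is represented by a total function whose
  values on \<open>E\<close> are discarded. This keeps arbitrary, possibly non-measurable values on a
  null set \<open>E\<close> from affecting integrability.
\<close>

definition off :: "'a set \<Rightarrow> ('a \<Rightarrow> 'b::zero) \<Rightarrow> 'a \<Rightarrow> 'b" where
  "off E f x = (if x \<in> E then 0 else f x)"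

end

theory Submission
  imports Defs
begin

text \<open>
  The identity holds coordinate by coordinate: for each \<open>i\<close>, the partial derivative
  \<open>\<partial>\<^sub>i muhat\<^sub>i\<close> is integrable and has the same expectation as \<open>muhat\<^sub>i (y\<^sub>i - \<mu>\<^sub>i) / \<sigma>\<^sup>2\<close>, namely the
  covariance of \<open>muhat\<^sub>i\<close> and \<open>y\<^sub>i\<close> divided by \<open>\<sigma>\<^sup>2\<close>. Summing over \<open>i\<close> gives the theorem.

  Fix \<open>i\<close>. Projecting \<open>E\<close> along the \<open>i\<close>-th axis does not increase \<open>(n-1)\<close>-dimensional Hausdorff
  measure, so the projection is a null set and almost every line parallel to that axis misses
  \<open>E\<close> (\<open>AE_line_avoids\<close>). On such a line \<open>muhat\<^sub>i\<close> is a continuously differentiable function of one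
  real variable, and Stein's identity there is integration by parts against the normal density.

  The boundary terms need care, since an integrable function need not tend to \<open>0\<close>. It does become
  arbitrarily small along suitable sequences \<open>a\<^sub>n \<rightarrow> -\<infinity>\<close> and \<open>b\<^sub>n \<rightarrow> \<infinity>\<close>. The integrals of its
  derivative over \<open>[a\<^sub>n, b\<^sub>n]\<close> then tend to \<open>0\<close>, and if one of the two signed parts of the derivative
  is integrable, Fatou's lemma makes the other one integrable too
  (\<open>integrable_deriv_of_integrable\<close>). Hence a one-sided bound suffices for Stein's identity on a
  line (\<open>stein_identity_line\<close>).

  The lines are put together by a resampling argument. If \<open>x\<close> has law \<open>N(\<mu>, \<sigma>\<^sup>2 I)\<close> and its \<open>i\<close>-th
  coordinate is replaced by an independent normal variable with mean \<open>\<mu>\<^sub>i\<close> and variance \<open>\<sigma>\<^sup>2\<close>, the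
  law stays the same (\<open>distr_replace_coord\<close>). Fubini's theorem for the pair of \<open>x\<close> and the new
  coordinate therefore expresses expectations as averages of integrals over lines, without splitting
  the index set \<open>'n\<close>. On a line, the integrals of the two signed parts of the derivative differ by
  the integral of \<open>muhat\<^sub>i (x\<^sub>i - \<mu>\<^sub>i) / \<sigma>\<^sup>2\<close>, which is integrable over the lines. If one part has
  finite expectation, so has the other; a partial derivative whose expectation exists in
  \<open>[-\<infinity>, \<infinity>]\<close> therefore has a finite one (\<open>stein_identity_coordinate\<close>). Both alternatives in the hypotheses provide this existence.
\<close>

section \<open>Integration by parts on a line\<close>

lemma integrable_frequently_small:
  fixes f :: "real \<Rightarrow> real"
  assumes f: "integrable lborel f" and e: "0 < e"
  obtains b where "B \<le> b" "\<bar>f b\<bar> < e"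
proof -
  have "\<exists>b\<ge>B. \<bar>f b\<bar> < e"
  proof (rule ccontr)
    assume *: "\<not> (\<exists>b\<ge>B. \<bar>f b\<bar> < e)"
    obtain r where r: "(\<integral>\<^sup>+x. ennreal (norm (f x)) \<partial>lborel) = ennreal r" "0 \<le> r"
      using f by (auto simp: integrable_iff_bounded less_top_ennreal)
    obtain N where N: "0 \<le> N" "r < e * N"
      using e r(2) by (metis divide_nonneg_pos less_add_one mult.commute order_trans less_imp_le pos_divide_less_eq)
    \<comment> \<open>As \<open>\<bar>f x\<bar> \<ge> e\<close> for all \<open>x \<ge> B\<close>, an interval of length \<open>N\<close> already contributes \<open>e * N\<close>.\<close>
    have "ennreal (e * N) = ennreal e * emeasure lborel {B..B + N}"
      using e N by (simp add: ennreal_mult)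
    also have "\<dots> = (\<integral>\<^sup>+x. ennreal e * indicator {B..B + N} x \<partial>lborel)"
      by (simp add: nn_integral_cmult_indicator)
    also have "\<dots> \<le> (\<integral>\<^sup>+x. ennreal (norm (f x)) \<partial>lborel)"
      using * by (intro nn_integral_mono) (auto split: split_indicator intro!: ennreal_leI simp: not_less)
    finally have "e * N \<le> r"
      using r by simp
    with N show False by simp
  qed
  then show thesis using that by blast
qed

text \<open>
  The fundamental theorem of calculus on intervals \<open>[a n, b n]\<close> that exhaust the line and whose end
  points are chosen so that \<open>\<psi> (a n)\<close> and \<open>\<psi> (b n)\<close> tend to \<open>0\<close>. With \<open>k\<close> the negative part of
  \<open>\<psi>'\<close>, the integrals of the nonnegative function \<open>\<psi>' + k\<close> over these intervals are bounded, so
  Fatou's lemma applies.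
\<close>

lemma integrable_deriv_of_integrable:
  fixes \<psi> \<psi>' :: "real \<Rightarrow> real"
  assumes \<psi>: "integrable lborel \<psi>"
    and deriv: "\<And>x. (\<psi> has_real_derivative \<psi>' x) (at x)"
    and cont: "continuous_on UNIV \<psi>'"
    and neg: "(\<integral>\<^sup>+x. ennreal (- \<psi>' x) \<partial>lborel) < \<infinity>"
  shows "integrable lborel \<psi>'" and "(\<integral>x. \<psi>' x \<partial>lborel) = 0"
proof -
  have meas[measurable]: "\<psi>' \<in> borel_measurable borel"
    using cont by (rule borel_measurable_continuous_onI)
  have refl: "integrable lborel (\<lambda>x. \<psi> (- x))"
    using lborel_integrable_real_affine[OF \<psi>, of "-1" 0] by simp
  have "\<exists>b\<ge>real n. \<bar>\<psi> b\<bar> < 1 / Suc n" for n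
    using integrable_frequently_small[OF \<psi>, of "1 / Suc n" "real n"] by auto
  then obtain b where b: "\<And>n. real n \<le> b n" "\<And>n. \<bar>\<psi> (b n)\<bar> < 1 / Suc n" by metis
  have "\<exists>a\<le>- real n. \<bar>\<psi> a\<bar> < 1 / Suc n" for n
  proof -
    obtain c where "real n \<le> c" "\<bar>\<psi> (- c)\<bar> < 1 / Suc n"
      using integrable_frequently_small[OF refl, of "1 / Suc n" "real n"] by auto
    then show ?thesis by (intro exI[of _ "- c"]) simp
  qed
  then obtain a where a: "\<And>n. a n \<le> - real n" "\<And>n. \<bar>\<psi> (a n)\<bar> < 1 / Suc n" by metis
  have ab: "a n \<le> b n" for n using a(1)[of n] b(1)[of n] by linarith
  have ftc: "has_bochner_integral lborel (\<lambda>x. \<psi>' x * indicator {a n..b n} x) (\<psi> (b n) - \<psi> (a n))" for n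
    by (rule has_bochner_integral_FTC_Icc_real[OF ab])
       (use deriv cont in \<open>auto simp: continuous_on_eq_continuous_at\<close>)
  have lim_ind: "(\<lambda>n. \<psi>' x * indicator {a n..b n} x) \<longlonglongrightarrow> \<psi>' x" for x
  proof (rule tendsto_eventually)
    have "eventually (\<lambda>n. \<bar>x\<bar> \<le> real n) sequentially"
      by (meson eventually_sequentiallyI le_nat_iff nat_ceiling_le_eq)
    then show "eventually (\<lambda>n. \<psi>' x * indicator {a n..b n} x = \<psi>' x) sequentially"
    proof eventually_elim
      case (elim n)
      then show ?case using a(1)[of n] b(1)[of n] by (auto simp: indicator_def)
    qed
  qed
  define k where "k x = max 0 (- \<psi>' x)" for x
  have k: "integrable lborel k"
    unfolding integrable_iff_bounded k_def using neg
    by (auto simp: ennreal_max_0)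
  have bound: "(\<integral>\<^sup>+x. ennreal ((\<psi>' x + k x) * indicator {a n..b n} x) \<partial>lborel)
      \<le> ennreal (2 + (\<integral>x. k x \<partial>lborel))" for n
  proof -
    have int: "integrable lborel (\<lambda>x. k x * indicator {a n..b n} x)"
      using k by (rule Bochner_Integration.integrable_bound) (auto simp: k_def indicator_def)
    have "(\<integral>\<^sup>+x. ennreal ((\<psi>' x + k x) * indicator {a n..b n} x) \<partial>lborel)
        = (\<integral>\<^sup>+x. ennreal (\<psi>' x * indicator {a n..b n} x + k x * indicator {a n..b n} x) \<partial>lborel)"
      by (simp add: algebra_simps)
    also have "\<dots> = ennreal (\<integral>x. \<psi>' x * indicator {a n..b n} x + k x * indicator {a n..b n} x \<partial>lborel)"
      using ftc[of n] int
      by (intro nn_integral_eq_integral Bochner_Integration.integrable_add)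
         (auto simp: has_bochner_integral_iff k_def indicator_def)
    also have "(\<integral>x. \<psi>' x * indicator {a n..b n} x + k x * indicator {a n..b n} x \<partial>lborel)
       = \<psi> (b n) - \<psi> (a n) + (\<integral>x. k x * indicator {a n..b n} x \<partial>lborel)"
      using ftc[of n] int by (simp add: has_bochner_integral_iff)
    also have "(\<integral>x. k x * indicator {a n..b n} x \<partial>lborel) \<le> (\<integral>x. k x \<partial>lborel)"
      by (rule integral_mono[OF int k]) (simp add: k_def indicator_def)
    also have "\<psi> (b n) - \<psi> (a n) \<le> 2"
    proof -
      have "1 / real (Suc n) \<le> 1" by simp
      then show ?thesis using a(2)[of n] b(2)[of n] by linarith
    qed
    finally show ?thesis by (simp add: ennreal_leI)
  qed
  have "(\<integral>\<^sup>+x. ennreal (\<psi>' x + k x) \<partial>lborel)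
      = (\<integral>\<^sup>+x. liminf (\<lambda>n. ennreal ((\<psi>' x + k x) * indicator {a n..b n} x)) \<partial>lborel)"
  proof (rule nn_integral_cong)
    fix x
    have "(\<lambda>n. k x * indicator {a n..b n} x) \<longlonglongrightarrow> k x"
      using lim_ind[of x] by (cases "\<psi>' x = 0")
        (auto simp: k_def max_def dest: tendsto_minus)
    from tendsto_add[OF lim_ind this]
    have "(\<lambda>n. ennreal ((\<psi>' x + k x) * indicator {a n..b n} x)) \<longlonglongrightarrow> ennreal (\<psi>' x + k x)"
      by (intro tendsto_ennrealI) (simp add: algebra_simps)
    then show "ennreal (\<psi>' x + k x) = liminf (\<lambda>n. ennreal ((\<psi>' x + k x) * indicator {a n..b n} x))"
      by (intro lim_imp_Liminf[symmetric]) simp_all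
  qed
  also have "\<dots> \<le> liminf (\<lambda>n. \<integral>\<^sup>+x. ennreal ((\<psi>' x + k x) * indicator {a n..b n} x) \<partial>lborel)"
    by (rule nn_integral_liminf) (simp add: k_def)
  also have "\<dots> \<le> ennreal (2 + (\<integral>x. k x \<partial>lborel))"
    by (rule order.trans[OF Liminf_le_Limsup Limsup_bounded]) (use bound in auto)
  finally have "(\<integral>\<^sup>+x. ennreal (\<psi>' x + k x) \<partial>lborel) < \<infinity>"
    by (rule le_less_trans) simp
  then have "integrable lborel (\<lambda>x. \<psi>' x + k x)"
    by (intro integrableI_nonneg) (auto simp: k_def)
  from Bochner_Integration.integrable_diff[OF this k]
  show int: "integrable lborel \<psi>'" by simp
  have "(\<lambda>n. \<integral>x. \<psi>' x * indicator {a n..b n} x \<partial>lborel) \<longlonglongrightarrow> (\<integral>x. \<psi>' x \<partial>lborel)"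
    by (rule integral_dominated_convergence[where w="\<lambda>x. \<bar>\<psi>' x\<bar>"])
       (use int lim_ind in \<open>auto simp: indicator_def\<close>)
  then have lim: "(\<lambda>n. \<psi> (b n) - \<psi> (a n)) \<longlonglongrightarrow> (\<integral>x. \<psi>' x \<partial>lborel)"
    using ftc by (simp add: has_bochner_integral_iff)
  have inv: "(\<lambda>n. 1 / real (Suc n)) \<longlonglongrightarrow> 0"
    using LIMSEQ_inverse_real_of_nat by (simp add: inverse_eq_divide)
  have "(\<lambda>n. \<psi> (b n)) \<longlonglongrightarrow> 0" "(\<lambda>n. \<psi> (a n)) \<longlonglongrightarrow> 0"
    by (rule Lim_null_comparison[OF always_eventually inv], use a b in \<open>auto intro: less_imp_le\<close>)+
  from tendsto_diff[OF this] lim show "(\<integral>x. \<psi>' x \<partial>lborel) = 0"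
    by (auto intro: LIMSEQ_unique)
qed

abbreviation normal_law :: "real \<Rightarrow> real \<Rightarrow> real measure" where
  "normal_law m \<sigma> \<equiv> density lborel (\<lambda>s. ennreal (normal_density m \<sigma> s))"

lemma has_real_derivative_normal_density:
  assumes "\<sigma> > 0"
  shows "(normal_density m \<sigma> has_real_derivative - ((s - m) / \<sigma>\<^sup>2) * normal_density m \<sigma> s) (at s)"
proof -
  have "((\<lambda>s. - (s - m)\<^sup>2 / (2 * \<sigma>\<^sup>2)) has_real_derivative - ((s - m) / \<sigma>\<^sup>2)) (at s)"
    using assms by (auto intro!: derivative_eq_intros simp: field_simps)
  from DERIV_cmult[OF DERIV_fun_exp[OF this], of "1 / sqrt (2 * pi * \<sigma>\<^sup>2)"]
  show ?thesis
    unfolding normal_density_def[abs_def] by (simp add: mult_ac)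
qed

text \<open>
  With \<open>\<phi>\<close> the normal density, \<open>(F \<phi>)' = F' \<phi> - F (s - m) / \<sigma>\<^sup>2 \<phi>\<close>, and the integral of the left-hand
  side over the line vanishes. Only the negative part of \<open>F'\<close> is controlled in advance;
  integrability of \<open>F'\<close> is part of the conclusion.
\<close>

lemma stein_identity_line:
  fixes F F' :: "real \<Rightarrow> real"
  assumes \<sigma>: "\<sigma> > 0"
    and deriv: "\<And>s. (F has_real_derivative F' s) (at s)"
    and cont: "continuous_on UNIV F'"
    and F: "integrable (normal_law m \<sigma>) F"
    and H: "integrable (normal_law m \<sigma>) (\<lambda>s. F s * (s - m) / \<sigma>\<^sup>2)"
    and neg: "(\<integral>\<^sup>+s. ennreal (- F' s) \<partial>normal_law m \<sigma>) < \<infinity>"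
  shows "integrable (normal_law m \<sigma>) F'"
    and "(\<integral>s. F' s \<partial>normal_law m \<sigma>) = (\<integral>s. F s * (s - m) / \<sigma>\<^sup>2 \<partial>normal_law m \<sigma>)"
proof -
  let ?\<phi> = "normal_density m \<sigma>"
  define h where "h s = ?\<phi> s * (F s * (s - m) / \<sigma>\<^sup>2)" for s
  have Fcont: "continuous_on UNIV F"
    using deriv by (auto intro!: continuous_at_imp_continuous_on DERIV_isCont)
  have [measurable]: "F \<in> borel_measurable borel" "F' \<in> borel_measurable borel"
    using Fcont cont by (auto intro: borel_measurable_continuous_onI)
  have phi_cont: "continuous_on UNIV ?\<phi>"
    using has_real_derivative_normal_density[OF \<sigma>]
    by (auto intro!: continuous_at_imp_continuous_on DERIV_isCont)
  have \<psi>: "integrable lborel (\<lambda>s. ?\<phi> s * F s)" and h: "integrable lborel h"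
    using F H by (simp_all add: integrable_real_density h_def[abs_def])
  have D: "((\<lambda>s. ?\<phi> s * F s) has_real_derivative (?\<phi> s * F' s - h s)) (at s)" for s
    using DERIV_mult[OF has_real_derivative_normal_density[OF \<sigma>] deriv, of m s]
    by (simp add: h_def algebra_simps)
  have C: "continuous_on UNIV (\<lambda>s. ?\<phi> s * F' s - h s)"
    unfolding h_def using \<sigma> by (intro continuous_intros Fcont cont phi_cont) auto
  have "(\<integral>\<^sup>+s. ennreal (- (?\<phi> s * F' s - h s)) \<partial>lborel)
      \<le> (\<integral>\<^sup>+s. ennreal (?\<phi> s) * ennreal (- F' s) + ennreal (norm (h s)) \<partial>lborel)"
  proof (rule nn_integral_mono)
    fix s
    have "- (?\<phi> s * F' s - h s) \<le> ?\<phi> s * max 0 (- F' s) + norm (h s)"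
    proof -
      have "?\<phi> s * (- F' s) \<le> ?\<phi> s * max 0 (- F' s)" by (intro mult_left_mono) auto
      then show ?thesis by (simp add: abs_if)
    qed
    then have "ennreal (- (?\<phi> s * F' s - h s)) \<le> ennreal (?\<phi> s * max 0 (- F' s) + norm (h s))"
      by (rule ennreal_leI)
    also have "\<dots> = ennreal (?\<phi> s) * ennreal (max 0 (- F' s)) + ennreal (norm (h s))"
      by (simp add: ennreal_plus ennreal_mult)
    finally show "ennreal (- (?\<phi> s * F' s - h s)) \<le> ennreal (?\<phi> s) * ennreal (- F' s) + ennreal (norm (h s))"
      by (simp add: ennreal_max_0)
  qed
  also have "\<dots> = (\<integral>\<^sup>+s. ennreal (- F' s) \<partial>normal_law m \<sigma>) + (\<integral>\<^sup>+s. ennreal (norm (h s)) \<partial>lborel)"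
    using h by (subst nn_integral_add) (auto simp: nn_integral_density)
  also have "\<dots> < \<infinity>"
    using neg h by (simp add: integrable_iff_bounded)
  finally have N: "(\<integral>\<^sup>+s. ennreal (- (?\<phi> s * F' s - h s)) \<partial>lborel) < \<infinity>" .
  note int = integrable_deriv_of_integrable[OF \<psi> D C N]
  have int': "integrable lborel (\<lambda>s. ?\<phi> s * F' s)"
    using Bochner_Integration.integrable_add[OF int(1) h] by simp
  then show "integrable (normal_law m \<sigma>) F'"
    by (simp add: integrable_real_density)
  have "(\<integral>s. ?\<phi> s * F' s \<partial>lborel) = (\<integral>s. h s \<partial>lborel)"
    using int(2) int' h by simp
  then show "(\<integral>s. F' s \<partial>normal_law m \<sigma>) = (\<integral>s. F s * (s - m) / \<sigma>\<^sup>2 \<partial>normal_law m \<sigma>)"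
    by (simp add: integral_real_density h_def[abs_def])
qed

section \<open>Lines that miss a Hausdorff null set\<close>

text \<open>
  The shadow of \<open>U\<close> along the \<open>i\<close>-th axis, cut off at height \<open>R\<close>, lies in a box whose \<open>i\<close>-th side has
  length \<open>2 R\<close> and whose other sides have length twice the diameter of \<open>U\<close>. Its volume is therefore
  a constant multiple of the Hausdorff gauge of \<open>U\<close>, with a factor that does not depend on \<open>U\<close>.
\<close>

lemma slab_shadow_covered_by_box:
  fixes U :: "(real^'n) set"
  assumes U: "bounded U" and R: "R > 0"
  defines "k \<equiv> CARD('n) - 1"
  obtains a b :: "real^'n" where
    "{x. \<bar>x $ i\<bar> \<le> R \<and> (\<exists>t. x + t *\<^sub>R axis i 1 \<in> U)} \<subseteq> cbox a b"
    "emeasure lborel (cbox a b) = ennreal (2 * R * 4 ^ k / unit_ball_vol (real k)) * hausdorff_gauge k U"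
proof (cases "U = {}")
  case True
  have "cbox (1 :: real^'n) 0 = {}" by (simp add: interval_eq_empty_cart)
  with True show ?thesis
    by (intro that[of 1 0]) (auto simp: hausdorff_gauge_def)
next
  case False
  then obtain p where p: "p \<in> U" by auto
  define d where "d = diameter U"
  have d: "d \<ge> 0" using U by (simp add: d_def diameter_ge_0)
  define a b :: "real^'n" where "a = (\<chi> j. if j = i then - R else p $ j - d)"
    and "b = (\<chi> j. if j = i then R else p $ j + d)"
  have "x \<in> cbox a b" if x: "\<bar>x $ i\<bar> \<le> R" "x + t *\<^sub>R axis i 1 \<in> U" for x t
  proof -
    have "\<bar>x $ j - p $ j\<bar> \<le> d" if "j \<noteq> i" for j
    proof -
      have "x $ j - p $ j = ((x + t *\<^sub>R axis i 1) - p) $ j" using that by (simp add: axis_def)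
      also have "\<bar>\<dots>\<bar> \<le> norm ((x + t *\<^sub>R axis i 1) - p)" by (rule component_le_norm_cart)
      also have "\<dots> \<le> d" using diameter_bounded_bound[OF U x(2) p] by (simp add: d_def dist_norm)
      finally show ?thesis .
    qed
    then show ?thesis
      using x(1) by (force simp: mem_box_cart a_def b_def abs_le_iff)
  qed
  then have sub: "{x. \<bar>x $ i\<bar> \<le> R \<and> (\<exists>t. x + t *\<^sub>R axis i 1 \<in> U)} \<subseteq> cbox a b" by auto
  have "cbox a b \<noteq> {}"
    using R d by (auto simp: interval_ne_empty_cart a_def b_def)
  then have "measure lborel (cbox a b) = (\<Prod>j\<in>UNIV. b $ j - a $ j)" by (rule content_cbox_cart)
  also have "\<dots> = (b $ i - a $ i) * (\<Prod>j\<in>UNIV - {i}. b $ j - a $ j)" by (simp add: prod.remove)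
  also have "(\<Prod>j\<in>UNIV - {i}. b $ j - a $ j) = (\<Prod>j\<in>UNIV - {i}. 2 * d)"
    by (intro prod.cong) (auto simp: a_def b_def)
  also have "\<dots> = (2 * d) ^ k" by (simp add: k_def card_Diff_singleton)
  also have "(2 * d) ^ k = 4 ^ k * (d / 2) ^ k"
    using power_mult_distrib[of 4 "d / 2" k] by simp
  also have "(b $ i - a $ i) * (4 ^ k * (d / 2) ^ k)
      = (2 * R * 4 ^ k / unit_ball_vol (real k)) * (unit_ball_vol (real k) * (d / 2) ^ k)"
    by (simp add: a_def b_def unit_ball_vol_pos[THEN less_imp_neq, symmetric])
  finally have m: "measure lborel (cbox a b)
      = (2 * R * 4 ^ k / unit_ball_vol (real k)) * (unit_ball_vol (real k) * (d / 2) ^ k)" .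
  have "emeasure lborel (cbox a b) = ennreal (measure lborel (cbox a b))"
    by (rule emeasure_eq_ennreal_measure) (simp add: emeasure_lborel_cbox_eq)
  also have "\<dots> = ennreal (2 * R * 4 ^ k / unit_ball_vol (real k)) * hausdorff_gauge k U"
    unfolding m using R d False
    by (subst ennreal_mult) (simp_all add: hausdorff_gauge_def d_def)
  finally show ?thesis using sub that by blast
qed

text \<open>
  A cover of \<open>E\<close> with small total gauge casts a shadow of small volume in every slab
  \<open>\<bar>x\<^sub>i\<bar> \<le> R\<close>. The full shadow is the union of countably many of these null sets.
\<close>

lemma AE_line_avoids:
  fixes E :: "(real^'n) set"
  assumes E: "hausdorff_measure (CARD('n) - 1) E = 0"
  shows "AE x in lborel. \<forall>t. x + t *\<^sub>R axis i 1 \<notin> E"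
proof -
  let ?k = "CARD('n) - 1"
  define shadow where "shadow R S = {x :: real^'n. \<bar>x $ i\<bar> \<le> R \<and> (\<exists>t. x + t *\<^sub>R axis i 1 \<in> S)}"
    for R :: real and S
  have pre: "hausdorff_premeasure ?k 1 E = 0"
    using E unfolding hausdorff_measure_def by (metis SUP_upper greaterThan_iff le_zero_eq zero_less_one)
  have null: "negligible (shadow R E)" if R: "R > 0" for R
    unfolding negligible_outer_le
  proof (intro allI impI)
    fix e :: real assume e: "e > 0"
    define C where "C = 2 * R * 4 ^ ?k / unit_ball_vol (real ?k)"
    have C: "C > 0" using R by (simp add: C_def)
    have "hausdorff_premeasure ?k 1 E < ennreal (e / C)"
      using pre e C by simp
    then obtain U :: "nat \<Rightarrow> (real^'n) set" where
      U: "E \<subseteq> (\<Union>j. U j)" "\<And>j. bounded (U j)" and less: "(\<Sum>j. hausdorff_gauge ?k (U j)) < ennreal (e / C)"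
      unfolding hausdorff_premeasure_def Inf_less_iff by blast
    have "\<exists>a b. shadow R (U j) \<subseteq> cbox a b \<and> emeasure lborel (cbox a b) = ennreal C * hausdorff_gauge ?k (U j)" for j
      unfolding C_def shadow_def
      by (rule slab_shadow_covered_by_box[OF U(2)[of j] R]) blast
    then obtain a b where ab: "\<And>j. shadow R (U j) \<subseteq> cbox (a j) (b j)"
      "\<And>j. emeasure lborel (cbox (a j) (b j)) = ennreal C * hausdorff_gauge ?k (U j)" by metis
    let ?T = "\<Union>j. cbox (a j) (b j)"
    have "emeasure lborel ?T \<le> (\<Sum>j. emeasure lborel (cbox (a j) (b j)))"
      by (rule emeasure_subadditive_countably) auto
    also have "\<dots> = ennreal C * (\<Sum>j. hausdorff_gauge ?k (U j))"
      by (simp add: ab(2))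
    also have "\<dots> \<le> ennreal C * ennreal (e / C)"
      using less by (intro mult_left_mono) auto
    also have "\<dots> = ennreal e"
      using C e by (simp flip: ennreal_mult)
    finally have T: "emeasure lebesgue ?T \<le> ennreal e" by simp
    have "shadow R E \<subseteq> ?T"
      using U(1) ab(1) unfolding shadow_def by blast
    moreover have "?T \<in> lmeasurable"
      using T by (intro fmeasurableI) (auto intro: le_less_trans)
    moreover have "measure lebesgue ?T \<le> e"
      using T e by (simp add: measure_def enn2real_leI)
    ultimately show "\<exists>T. shadow R E \<subseteq> T \<and> T \<in> lmeasurable \<and> measure lebesgue T \<le> e" by blast
  qed
  have "negligible (\<Union>n. shadow (real (Suc n)) E)"
    using null by (intro negligible_Union_nat) auto
  moreover have "{x. \<not> (\<forall>t. x + t *\<^sub>R axis i 1 \<notin> E)} \<subseteq> (\<Union>n. shadow (real (Suc n)) E)"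
  proof
    fix x assume "x \<in> {x. \<not> (\<forall>t. x + t *\<^sub>R axis i 1 \<notin> E)}"
    moreover obtain n where "\<bar>x $ i\<bar> \<le> real n" using real_arch_simple by blast
    ultimately show "x \<in> (\<Union>n. shadow (real (Suc n)) E)"
      by (auto simp: shadow_def intro!: exI[of _ n])
  qed
  ultimately have "{x. \<not> (\<forall>t. x + t *\<^sub>R axis i 1 \<notin> E)} \<in> null_sets lebesgue"
    using negligible_subset negligible_iff_null_sets by blast
  then have "AE x in lebesgue. \<forall>t. x + t *\<^sub>R axis i 1 \<notin> E"
    by (simp add: completion.AE_iff_null_sets)
  then show ?thesis by (simp add: AE_completion_iff)
qed

section \<open>Resampling one coordinate of a Gaussian vector\<close>

abbreviation isotropic_normal :: "real^'n \<Rightarrow> real \<Rightarrow> (real^'n) measure" where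
  "isotropic_normal \<mu> \<sigma> \<equiv> density lborel (\<lambda>x. ennreal (isotropic_normal_density \<mu> \<sigma> x))"

definition replace_coord :: "'n \<Rightarrow> real^'n \<Rightarrow> real \<Rightarrow> real^'n" where
  "replace_coord i x s = x + (s - x $ i) *\<^sub>R axis i 1"

lemma replace_coord_nth [simp]: "replace_coord i x s $ j = (if j = i then s else x $ j)"
  by (auto simp: replace_coord_def axis_def)

text \<open>
  The detailed balance of resampling: the vector \<open>x - t e\<^sub>i\<close> together with the new coordinate \<open>x\<^sub>i\<close> is
  as likely as the vector \<open>x\<close> together with the new coordinate \<open>x\<^sub>i - t\<close>.
\<close>

lemma isotropic_normal_density_exchange:
  "isotropic_normal_density \<mu> \<sigma> (x - t *\<^sub>R axis i 1) * normal_density (\<mu> $ i) \<sigma> (x $ i)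
   = isotropic_normal_density \<mu> \<sigma> x * normal_density (\<mu> $ i) \<sigma> (x $ i - t)"
proof -
  have "(\<Prod>j\<in>UNIV-{i}. normal_density (\<mu> $ j) \<sigma> ((x - t *\<^sub>R axis i 1) $ j))
      = (\<Prod>j\<in>UNIV-{i}. normal_density (\<mu> $ j) \<sigma> (x $ j))"
    by (intro prod.cong) (auto simp: axis_def)
  then show ?thesis
    by (simp add: isotropic_normal_density_def prod.remove[of UNIV i] mult_ac)
qed

lemma isotropic_normal_density_nonneg: "0 \<le> isotropic_normal_density \<mu> \<sigma> x"
  by (simp add: isotropic_normal_density_def prod_nonneg)

lemma borel_measurable_isotropic_normal_density [measurable]:
  "isotropic_normal_density \<mu> \<sigma> \<in> borel_measurable borel"
  unfolding isotropic_normal_density_def[abs_def] by measurable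

lemma borel_measurable_vec_component [measurable]: "(\<lambda>x::real^'n. x $ i) \<in> borel_measurable borel"
  by (intro borel_measurable_continuous_onI continuous_intros)

lemma measurable_replace_coord [measurable]:
  "(\<lambda>(x, s). replace_coord i x s) \<in> borel_measurable (borel \<Otimes>\<^sub>M borel)"
  unfolding replace_coord_def by measurable

text \<open>
  Writing the new coordinate as \<open>x\<^sub>i + t\<close>, the resampled vector is the translate \<open>x + t e\<^sub>i\<close>. For
  fixed \<open>t\<close>, translation invariance of Lebesgue measure removes this shift from the vector, and the
  exchange relation above leaves the old density times a normal density in \<open>t\<close>, which integrates
  to \<open>1\<close>.
\<close>

lemma distr_replace_coord:
  fixes \<mu> :: "real^'n"
  assumes \<sigma>: "\<sigma> > 0"
  shows "distr (isotropic_normal \<mu> \<sigma> \<Otimes>\<^sub>M normal_law (\<mu> $ i) \<sigma>) borel (\<lambda>(x, s). replace_coord i x s)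
       = isotropic_normal \<mu> \<sigma>"
proof (rule measure_eqI)
  let ?P = "isotropic_normal \<mu> \<sigma> \<Otimes>\<^sub>M normal_law (\<mu> $ i) \<sigma>" and ?e = "axis i 1 :: real^'n"
  let ?\<phi> = "normal_density (\<mu> $ i) \<sigma>" and ?\<rho> = "isotropic_normal_density \<mu> \<sigma>"
  show "sets (distr ?P borel (\<lambda>(x, s). replace_coord i x s)) = sets (isotropic_normal \<mu> \<sigma>)" by simp
  interpret G: prob_space "normal_law (\<mu> $ i) \<sigma>" using \<sigma> by (rule prob_space_normal_density)
  have total: "(\<integral>\<^sup>+s. ennreal (?\<phi> s) \<partial>lborel) = 1"
    using G.emeasure_space_1 by (simp add: emeasure_density)
  fix A assume "A \<in> sets (distr ?P borel (\<lambda>(x, s). replace_coord i x s))"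
  then have A[measurable]: "A \<in> sets borel" by simp
  have "emeasure (distr ?P borel (\<lambda>(x, s). replace_coord i x s)) A
      = (\<integral>\<^sup>+z. indicator A (case z of (x, s) \<Rightarrow> replace_coord i x s) \<partial>?P)"
    using nn_integral_distr[of "\<lambda>(x, s). replace_coord i x s" ?P borel "indicator A"] by simp
  also have "\<dots> = (\<integral>\<^sup>+x. \<integral>\<^sup>+s. indicator A (replace_coord i x s) \<partial>normal_law (\<mu> $ i) \<sigma> \<partial>isotropic_normal \<mu> \<sigma>)"
    by (subst G.nn_integral_fst[symmetric]) (simp_all)
  also have "\<dots> = (\<integral>\<^sup>+x. ennreal (?\<rho> x) * (\<integral>\<^sup>+s. ennreal (?\<phi> s) * indicator A (replace_coord i x s) \<partial>lborel) \<partial>lborel)"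
    by (simp add: nn_integral_density)
  also have "\<dots> = (\<integral>\<^sup>+x. ennreal (?\<rho> x) * (\<integral>\<^sup>+t. ennreal (?\<phi> (x $ i + t)) * indicator A (x + t *\<^sub>R ?e) \<partial>lborel) \<partial>lborel)"
  proof -
    have "(\<integral>\<^sup>+s. ennreal (?\<phi> s) * indicator A (replace_coord i x s) \<partial>lborel)
        = (\<integral>\<^sup>+t. ennreal (?\<phi> (x $ i + t)) * indicator A (x + t *\<^sub>R ?e) \<partial>lborel)" for x
      by (subst nn_integral_real_affine[where c=1 and t="x $ i"]) (simp_all add: replace_coord_def)
    then show ?thesis by simp
  qed
  also have "\<dots> = (\<integral>\<^sup>+x. \<integral>\<^sup>+t. ennreal (?\<rho> x) * (ennreal (?\<phi> (x $ i + t)) * indicator A (x + t *\<^sub>R ?e)) \<partial>lborel \<partial>lborel)"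
    by (intro nn_integral_cong nn_integral_cmult[symmetric]) measurable
  also have "\<dots> = (\<integral>\<^sup>+t. \<integral>\<^sup>+x. ennreal (?\<rho> x) * (ennreal (?\<phi> (x $ i + t)) * indicator A (x + t *\<^sub>R ?e)) \<partial>lborel \<partial>lborel)"
    by (intro lborel_pair.Fubini') simp
  also have "\<dots> = (\<integral>\<^sup>+t. \<integral>\<^sup>+x. ennreal (?\<rho> x * ?\<phi> (x $ i - t)) * indicator A x \<partial>lborel \<partial>lborel)"
  proof (rule nn_integral_cong)
    fix t :: real
    have "(\<integral>\<^sup>+x. ennreal (?\<rho> x * ?\<phi> (x $ i - t)) * indicator A x \<partial>lborel)
        = (\<integral>\<^sup>+x. ennreal (?\<rho> (x - t *\<^sub>R ?e) * ?\<phi> (x $ i)) * indicator A x \<partial>lborel)"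
      by (simp add: isotropic_normal_density_exchange)
    also have "\<dots> = (\<integral>\<^sup>+x. ennreal (?\<rho> x * ?\<phi> (x $ i + t)) * indicator A (x + t *\<^sub>R ?e) \<partial>lborel)"
      by (subst lborel_distr_plus[symmetric, of "t *\<^sub>R ?e"])
         (simp add: nn_integral_distr add.commute axis_def)
    finally show "(\<integral>\<^sup>+x. ennreal (?\<rho> x) * (ennreal (?\<phi> (x $ i + t)) * indicator A (x + t *\<^sub>R ?e)) \<partial>lborel)
        = (\<integral>\<^sup>+x. ennreal (?\<rho> x * ?\<phi> (x $ i - t)) * indicator A x \<partial>lborel)"
      by (simp add: ennreal_mult isotropic_normal_density_nonneg mult.assoc)
  qed
  also have "\<dots> = (\<integral>\<^sup>+x. \<integral>\<^sup>+t. ennreal (?\<rho> x * ?\<phi> (x $ i - t)) * indicator A x \<partial>lborel \<partial>lborel)"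
    by (intro lborel_pair.Fubini'[symmetric]) simp
  also have "\<dots> = (\<integral>\<^sup>+x. ennreal (?\<rho> x) * indicator A x \<partial>lborel)"
  proof (rule nn_integral_cong)
    fix x :: "real^'n"
    have "(\<integral>\<^sup>+t. ennreal (?\<rho> x * ?\<phi> (x $ i - t)) * indicator A x \<partial>lborel)
        = (\<integral>\<^sup>+t. (ennreal (?\<rho> x) * indicator A x) * ennreal (?\<phi> (x $ i - t)) \<partial>lborel)"
      by (simp add: ennreal_mult isotropic_normal_density_nonneg mult_ac)
    also have "\<dots> = (ennreal (?\<rho> x) * indicator A x) * (\<integral>\<^sup>+t. ennreal (?\<phi> (x $ i - t)) \<partial>lborel)"
      by (rule nn_integral_cmult) simp
    also have "(\<integral>\<^sup>+t. ennreal (?\<phi> (x $ i - t)) \<partial>lborel) = 1"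
      using nn_integral_real_affine[where c="-1" and t="x $ i" and f="\<lambda>s. ennreal (?\<phi> s)"] total by simp
    finally show "(\<integral>\<^sup>+t. ennreal (?\<rho> x * ?\<phi> (x $ i - t)) * indicator A x \<partial>lborel) = ennreal (?\<rho> x) * indicator A x"
      by simp
  qed
  also have "\<dots> = emeasure (isotropic_normal \<mu> \<sigma>) A"
    by (simp add: emeasure_density)
  finally show "emeasure (distr ?P borel (\<lambda>(x, s). replace_coord i x s)) A = emeasure (isotropic_normal \<mu> \<sigma>) A" .
qed

text \<open>Resampling also gives the marginals: the resampled coordinate is normal by construction.\<close>

lemma distr_isotropic_normal_nth:
  assumes \<sigma>: "\<sigma> > 0" and N: "prob_space (isotropic_normal \<mu> \<sigma>)"
  shows "distr (isotropic_normal \<mu> \<sigma>) borel (\<lambda>x. x $ i) = normal_law (\<mu> $ i) \<sigma>"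
proof -
  interpret N: prob_space "isotropic_normal \<mu> \<sigma>" by fact
  interpret G: prob_space "normal_law (\<mu> $ i) \<sigma>" using \<sigma> by (rule prob_space_normal_density)
  interpret P: pair_sigma_finite "isotropic_normal \<mu> \<sigma>" "normal_law (\<mu> $ i) \<sigma>" ..
  let ?P = "isotropic_normal \<mu> \<sigma> \<Otimes>\<^sub>M normal_law (\<mu> $ i) \<sigma>"
  have "distr (isotropic_normal \<mu> \<sigma>) borel (\<lambda>x. x $ i)
      = distr (distr ?P borel (\<lambda>(x, s). replace_coord i x s)) borel (\<lambda>x. x $ i)"
    by (simp only: distr_replace_coord[OF \<sigma>])
  also have "\<dots> = distr ?P borel snd"
    by (subst distr_distr) (auto simp: comp_def split_beta' intro!: distr_cong)
  also have "\<dots> = normal_law (\<mu> $ i) \<sigma>"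
  proof (rule measure_eqI)
    fix A assume "A \<in> sets (distr ?P borel snd)"
    then have [measurable]: "A \<in> sets borel" by simp
    have "emeasure (distr ?P borel snd) A = emeasure ?P (UNIV \<times> A)"
      by (subst emeasure_distr) (auto intro!: arg_cong[where f="emeasure ?P"] simp: space_pair_measure)
    also have "\<dots> = emeasure (normal_law (\<mu> $ i) \<sigma>) A"
      using N.emeasure_space_1 by (subst G.emeasure_pair_measure_Times) auto
    finally show "emeasure (distr ?P borel snd) A = emeasure (normal_law (\<mu> $ i) \<sigma>) A" .
  qed simp
  finally show ?thesis .
qed

text \<open>
  Stein's identity on almost every line, averaged over the lines. On each line the integral of the
  positive part of \<open>g\<close> equals that of \<open>f (x\<^sub>i - \<mu>\<^sub>i) / \<sigma>\<^sup>2\<close> plus that of the negative part. Both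
  are integrable over the lines, so the positive part has finite expectation, and Fubini's theorem
  becomes applicable to \<open>g\<close>.
\<close>

lemma stein_identity_coordinate:
  fixes f g :: "real^'n \<Rightarrow> real"
  assumes \<sigma>: "\<sigma> > 0" and N: "prob_space (isotropic_normal \<mu> \<sigma>)"
    and [measurable]: "f \<in> borel_measurable borel" "g \<in> borel_measurable borel"
    and line: "AE x in lborel.
      (\<forall>s. ((\<lambda>s. f (replace_coord i x s)) has_real_derivative g (replace_coord i x s)) (at s)) \<and>
      continuous_on UNIV (\<lambda>s. g (replace_coord i x s))"
    and f: "integrable (isotropic_normal \<mu> \<sigma>) f"
    and h: "integrable (isotropic_normal \<mu> \<sigma>) (\<lambda>x. f x * (x $ i - \<mu> $ i) / \<sigma>\<^sup>2)"
    and neg: "(\<integral>\<^sup>+x. ennreal (- g x) \<partial>isotropic_normal \<mu> \<sigma>) < \<infinity>"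
  shows "integrable (isotropic_normal \<mu> \<sigma>) g"
    and "(\<integral>x. g x \<partial>isotropic_normal \<mu> \<sigma>)
       = (\<integral>x. f x * (x $ i - \<mu> $ i) / \<sigma>\<^sup>2 \<partial>isotropic_normal \<mu> \<sigma>)"
proof -
  define N where "N = isotropic_normal \<mu> \<sigma>"
  define G where "G = normal_law (\<mu> $ i) \<sigma>"
  define T where "T = (\<lambda>(x::real^'n, s). replace_coord i x s)"
  interpret N: prob_space N using N by (simp add: N_def)
  interpret G: prob_space G unfolding G_def using \<sigma> by (rule prob_space_normal_density)
  interpret P: pair_sigma_finite N G ..
  have [measurable_cong]: "sets N = sets borel" "sets G = sets borel" by (simp_all add: N_def G_def)
  have T[measurable]: "T \<in> borel_measurable (N \<Otimes>\<^sub>M G)" unfolding T_def by measurable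
  have inv: "distr (N \<Otimes>\<^sub>M G) borel T = N"
    using distr_replace_coord[OF \<sigma>] by (simp add: N_def G_def T_def)
  have resample_nn: "(\<integral>\<^sup>+x. u x \<partial>N) = (\<integral>\<^sup>+x. \<integral>\<^sup>+s. u (replace_coord i x s) \<partial>G \<partial>N)"
    if [measurable]: "u \<in> borel_measurable borel" for u :: "real^'n \<Rightarrow> ennreal"
  proof -
    have "(\<integral>\<^sup>+x. u x \<partial>N) = (\<integral>\<^sup>+x. u x \<partial>distr (N \<Otimes>\<^sub>M G) borel T)" by (simp only: inv)
    also have "\<dots> = (\<integral>\<^sup>+z. u (T z) \<partial>(N \<Otimes>\<^sub>M G))" by (rule nn_integral_distr) simp_all
    also have "\<dots> = (\<integral>\<^sup>+x. \<integral>\<^sup>+s. u (T (x, s)) \<partial>G \<partial>N)"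
      by (rule G.nn_integral_fst[symmetric]) simp
    finally show ?thesis by (simp add: T_def)
  qed
  have resample_int: "integrable (N \<Otimes>\<^sub>M G) (\<lambda>z. u (T z))" "(\<integral>x. u x \<partial>N) = (\<integral>x. \<integral>s. u (replace_coord i x s) \<partial>G \<partial>N)"
    if u: "integrable N u" for u :: "real^'n \<Rightarrow> real"
  proof -
    have [measurable]: "u \<in> borel_measurable borel" using borel_measurable_integrable[OF u] by simp
    have "integrable (distr (N \<Otimes>\<^sub>M G) borel T) u" using u by (simp only: inv)
    then show int: "integrable (N \<Otimes>\<^sub>M G) (\<lambda>z. u (T z))"
      by (simp add: integrable_distr_eq)
    have "(\<integral>x. u x \<partial>N) = (\<integral>x. u x \<partial>distr (N \<Otimes>\<^sub>M G) borel T)" by (simp only: inv)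
    also have "\<dots> = (\<integral>z. u (T z) \<partial>(N \<Otimes>\<^sub>M G))" by (rule integral_distr) simp_all
    also have "\<dots> = (\<integral>x. \<integral>s. u (T (x, s)) \<partial>G \<partial>N)"
      using int by (rule P.integral_fst'[symmetric])
    finally show "(\<integral>x. u x \<partial>N) = (\<integral>x. \<integral>s. u (replace_coord i x s) \<partial>G \<partial>N)" by (simp add: T_def)
  qed
  define h where "h x = f x * (x $ i - \<mu> $ i) / \<sigma>\<^sup>2" for x
  have f': "integrable N f" and h': "integrable N h" and neg': "(\<integral>\<^sup>+x. ennreal (- g x) \<partial>N) < \<infinity>"
    using f h neg by (simp_all add: N_def h_def[abs_def])
  have [measurable]: "h \<in> borel_measurable borel" unfolding h_def[abs_def] by measurable
  have "AE x in N. integrable G (\<lambda>s. f (replace_coord i x s))"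
    using P.AE_integrable_fst'[OF resample_int(1)[OF f']] by (simp add: T_def)
  moreover have "AE x in N. integrable G (\<lambda>s. h (replace_coord i x s))"
    using P.AE_integrable_fst'[OF resample_int(1)[OF h']] by (simp add: T_def)
  moreover have "AE x in N. (\<integral>\<^sup>+s. ennreal (- g (replace_coord i x s)) \<partial>G) \<noteq> \<infinity>"
    using neg' resample_nn[of "\<lambda>x. ennreal (- g x)"] by (intro nn_integral_PInf_AE) auto
  moreover have "AE x in N. (\<forall>s. ((\<lambda>s. f (replace_coord i x s)) has_real_derivative g (replace_coord i x s)) (at s)) \<and>
      continuous_on UNIV (\<lambda>s. g (replace_coord i x s))"
    unfolding N_def using line by (subst AE_density) auto
  ultimately have inner: "AE x in N. integrable G (\<lambda>s. g (replace_coord i x s)) \<and>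
      (\<integral>s. g (replace_coord i x s) \<partial>G) = (\<integral>s. h (replace_coord i x s) \<partial>G)"
  proof eventually_elim
    case (elim x)
    have "integrable G (\<lambda>s. f (replace_coord i x s) * (s - \<mu> $ i) / \<sigma>\<^sup>2)"
      using elim(2) by (simp add: h_def)
    with elim(1,3,4) show ?case
      using stein_identity_line[OF \<sigma>, of "\<lambda>s. f (replace_coord i x s)" "\<lambda>s. g (replace_coord i x s)" "\<mu> $ i"]
      by (simp add: G_def h_def less_top)
  qed
  have "(\<integral>\<^sup>+x. ennreal (g x) \<partial>N) = (\<integral>\<^sup>+x. \<integral>\<^sup>+s. ennreal (g (replace_coord i x s)) \<partial>G \<partial>N)"
    by (rule resample_nn) simp
  \<comment> \<open>Integrability of \<open>g\<close> is not yet known, so this comparison is made with nonnegative integrals.\<close>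
  also have "\<dots> \<le> (\<integral>\<^sup>+x. (\<integral>\<^sup>+s. ennreal (norm (h (replace_coord i x s))) \<partial>G)
      + (\<integral>\<^sup>+s. ennreal (- g (replace_coord i x s)) \<partial>G) \<partial>N)"
  proof (rule nn_integral_mono_AE)
    show "AE x in N. (\<integral>\<^sup>+s. ennreal (g (replace_coord i x s)) \<partial>G)
      \<le> (\<integral>\<^sup>+s. ennreal (norm (h (replace_coord i x s))) \<partial>G) + (\<integral>\<^sup>+s. ennreal (- g (replace_coord i x s)) \<partial>G)"
      using inner \<open>AE x in N. integrable G (\<lambda>s. h (replace_coord i x s))\<close>
    proof eventually_elim
      case (elim x)
      let ?g = "\<lambda>s. g (replace_coord i x s)" and ?h = "\<lambda>s. h (replace_coord i x s)"
      have g: "integrable G ?g" using elim by simp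
      have gp: "integrable G (\<lambda>s. max 0 (?g s))" and gn: "integrable G (\<lambda>s. max 0 (- ?g s))"
        using g by (auto intro: integrable_max)
      have "(\<integral>s. max 0 (?g s) \<partial>G) = (\<integral>s. ?g s + max 0 (- ?g s) \<partial>G)"
        by (intro Bochner_Integration.integral_cong) auto
      also have "\<dots> = (\<integral>s. ?h s \<partial>G) + (\<integral>s. max 0 (- ?g s) \<partial>G)"
        using g gn elim by simp
      also have "(\<integral>s. ?h s \<partial>G) \<le> (\<integral>s. norm (?h s) \<partial>G)"
        using elim by (intro integral_mono) auto
      finally have "ennreal (\<integral>s. max 0 (?g s) \<partial>G) \<le> ennreal ((\<integral>s. norm (?h s) \<partial>G) + (\<integral>s. max 0 (- ?g s) \<partial>G))"
        by (intro ennreal_leI) simp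
      also have "\<dots> = ennreal (\<integral>s. norm (?h s) \<partial>G) + ennreal (\<integral>s. max 0 (- ?g s) \<partial>G)"
        by (intro ennreal_plus integral_nonneg_AE) auto
      finally have "(\<integral>\<^sup>+s. ennreal (max 0 (?g s)) \<partial>G)
          \<le> (\<integral>\<^sup>+s. ennreal (norm (?h s)) \<partial>G) + (\<integral>\<^sup>+s. ennreal (max 0 (- ?g s)) \<partial>G)"
        using nn_integral_eq_integral[OF gp] nn_integral_eq_integral[OF gn] elim
        by (simp add: nn_integral_eq_integral)
      then show ?case by (simp add: ennreal_max_0)
    qed
  qed
  also have "\<dots> = (\<integral>\<^sup>+x. ennreal (norm (h x)) \<partial>N) + (\<integral>\<^sup>+x. ennreal (- g x) \<partial>N)"
    using resample_nn[of "\<lambda>x. ennreal (- g x)"] resample_nn[of "\<lambda>x. ennreal (norm (h x))"]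
    by (subst nn_integral_add) simp_all
  also have "\<dots> < \<infinity>" using h' neg' by (simp add: integrable_iff_bounded)
  finally have pos': "(\<integral>\<^sup>+x. ennreal (g x) \<partial>N) < \<infinity>" .
  have g: "integrable N g"
    using pos' neg' by (simp add: real_integrable_def less_top)
  then show "integrable (isotropic_normal \<mu> \<sigma>) g" by (simp add: N_def)
  have "(\<integral>x. g x \<partial>N) = (\<integral>x. \<integral>s. g (replace_coord i x s) \<partial>G \<partial>N)"
    by (rule resample_int(2)[OF g])
  also have "\<dots> = (\<integral>x. \<integral>s. h (replace_coord i x s) \<partial>G \<partial>N)"
    using inner by (intro integral_cong_AE) auto
  also have "\<dots> = (\<integral>x. h x \<partial>N)"
    by (rule resample_int(2)[OF h', symmetric])
  finally show "(\<integral>x. g x \<partial>isotropic_normal \<mu> \<sigma>) = (\<integral>x. f x * (x $ i - \<mu> $ i) / \<sigma>\<^sup>2 \<partial>isotropic_normal \<mu> \<sigma>)"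
    by (simp add: N_def h_def[abs_def])
qed

text \<open>Passing to \<open>- f\<close> and \<open>- g\<close> exchanges the two signed parts of \<open>g\<close>.\<close>

lemma stein_identity_coordinate_two_sided:
  fixes f g :: "real^'n \<Rightarrow> real"
  assumes \<sigma>: "\<sigma> > 0" and N: "prob_space (isotropic_normal \<mu> \<sigma>)"
    and [measurable]: "f \<in> borel_measurable borel" "g \<in> borel_measurable borel"
    and line: "AE x in lborel.
      (\<forall>s. ((\<lambda>s. f (replace_coord i x s)) has_real_derivative g (replace_coord i x s)) (at s)) \<and>
      continuous_on UNIV (\<lambda>s. g (replace_coord i x s))"
    and f: "integrable (isotropic_normal \<mu> \<sigma>) f"
    and h: "integrable (isotropic_normal \<mu> \<sigma>) (\<lambda>x. f x * (x $ i - \<mu> $ i) / \<sigma>\<^sup>2)"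
    and g: "(\<integral>\<^sup>+x. ennreal (g x) \<partial>isotropic_normal \<mu> \<sigma>) < \<infinity> \<or>
      (\<integral>\<^sup>+x. ennreal (- g x) \<partial>isotropic_normal \<mu> \<sigma>) < \<infinity>"
  shows "integrable (isotropic_normal \<mu> \<sigma>) g \<and>
      (\<integral>x. g x \<partial>isotropic_normal \<mu> \<sigma>)
       = (\<integral>x. f x * (x $ i - \<mu> $ i) / \<sigma>\<^sup>2 \<partial>isotropic_normal \<mu> \<sigma>)"
  using g
proof
  assume pos: "(\<integral>\<^sup>+x. ennreal (g x) \<partial>isotropic_normal \<mu> \<sigma>) < \<infinity>"
  have line': "AE x in lborel.
      (\<forall>s. ((\<lambda>s. - f (replace_coord i x s)) has_real_derivative - g (replace_coord i x s)) (at s)) \<and>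
      continuous_on UNIV (\<lambda>s. - g (replace_coord i x s))"
    using line by eventually_elim (auto intro: DERIV_minus continuous_on_minus)
  have h': "integrable (isotropic_normal \<mu> \<sigma>) (\<lambda>x. - f x * (x $ i - \<mu> $ i) / \<sigma>\<^sup>2)"
    using h[THEN Bochner_Integration.integrable_minus] by simp
  have "integrable (isotropic_normal \<mu> \<sigma>) (\<lambda>x. - g x)"
    "(\<integral>x. - g x \<partial>isotropic_normal \<mu> \<sigma>)
       = (\<integral>x. - f x * (x $ i - \<mu> $ i) / \<sigma>\<^sup>2 \<partial>isotropic_normal \<mu> \<sigma>)"
    using stein_identity_coordinate[OF \<sigma> N _ _ line' Bochner_Integration.integrable_minus[OF f] h'] pos
    by simp_all
  then show ?thesis by simp
next
  assume "(\<integral>\<^sup>+x. ennreal (- g x) \<partial>isotropic_normal \<mu> \<sigma>) < \<infinity>"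
  then show ?thesis
    using stein_identity_coordinate[OF \<sigma> N _ _ line f h] by simp
qed

section \<open>The divergence form\<close>

lemma has_real_derivative_along_axis:
  fixes F :: "real^'n \<Rightarrow> real^'m"
  assumes "(F has_derivative F') (at (z + s *\<^sub>R axis i 1))"
  shows "((\<lambda>t. F (z + t *\<^sub>R axis i 1) $ j) has_real_derivative F' (axis i 1) $ j) (at s)"
proof -
  have "((\<lambda>t. z + t *\<^sub>R axis i 1 :: real^'n) has_derivative (\<lambda>h. h *\<^sub>R axis i 1)) (at s)"
    by (auto intro!: derivative_eq_intros)
  from has_derivative_compose[OF this assms]
  have "((\<lambda>t. F (z + t *\<^sub>R axis i 1) $ j) has_derivative (\<lambda>h. F' (h *\<^sub>R axis i 1) $ j)) (at s)"
    by (rule bounded_linear.has_derivative[OF bounded_linear_vec_nth])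
  moreover have "(\<lambda>h. F' (h *\<^sub>R axis i 1) $ j) = (*) (F' (axis i 1) $ j)"
    using linear_cmul[OF has_derivative_linear[OF assms]] by (auto simp: mult.commute)
  ultimately show ?thesis by (simp add: has_field_derivative_def)
qed

lemma replace_coord_eq: "replace_coord i x s = (x - (x $ i) *\<^sub>R axis i 1) + s *\<^sub>R axis i 1"
  by (simp add: replace_coord_def algebra_simps)

theorem proposition1:
  fixes M :: "'a measure" and y :: "'a \<Rightarrow> real^'n"
    and \<mu> :: "real^'n" and \<sigma> :: real
    and E :: "(real^'n) set" and muhat :: "real^'n \<Rightarrow> real^'n"
  assumes "prob_space M"
    and "\<sigma> > 0"
    and "distributed M lborel y (\<lambda>x. ennreal (isotropic_normal_density \<mu> \<sigma> x))"
    and "closed E"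
    and "continuously_differentiable_on muhat (- E)"
    and "integrable M (\<lambda>\<omega>. (norm (off E muhat (y \<omega>)))\<^sup>2)"
    and "hausdorff_measure (CARD('n) - 1) E = 0"
    and "(\<Sum>i\<in>UNIV. \<integral>\<^sup>+\<omega>. ennreal \<bar>off E (partial_deriv i (\<lambda>x. muhat x $ i)) (y \<omega>)\<bar> \<partial>M) < \<infinity> \<or>
         (AE x in lborel. x \<notin> E \<longrightarrow> divergence muhat x \<ge> 0) \<and>
         (\<forall>i. expectation_exists M (\<lambda>\<omega>. off E (partial_deriv i (\<lambda>x. muhat x $ i)) (y \<omega>)))"
  shows "(\<forall>i. integrable M (\<lambda>\<omega>. off E (partial_deriv i (\<lambda>x. muhat x $ i)) (y \<omega>))) \<and>
         integrable M (\<lambda>\<omega>. off E (divergence muhat) (y \<omega>)) \<and>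
         1 / \<sigma>\<^sup>2 * (\<Sum>i\<in>UNIV. covariance M (\<lambda>\<omega>. off E muhat (y \<omega>) $ i) (\<lambda>\<omega>. y \<omega> $ i)) =
           (\<Sum>i\<in>UNIV. \<integral>\<omega>. off E (partial_deriv i (\<lambda>x. muhat x $ i)) (y \<omega>) \<partial>M) \<and>
         (\<Sum>i\<in>UNIV. \<integral>\<omega>. off E (partial_deriv i (\<lambda>x. muhat x $ i)) (y \<omega>) \<partial>M) =
           (\<integral>\<omega>. off E (divergence muhat) (y \<omega>) \<partial>M)"
proof -
  interpret M: prob_space M by fact
  note \<sigma> = \<open>\<sigma> > 0\<close>
  define N where "N = isotropic_normal \<mu> \<sigma>"
  define f where "f i x = off E muhat x $ i" for i x
  define g where "g i = off E (partial_deriv i (\<lambda>x. muhat x $ i))" for i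
  have [measurable_cong]: "sets N = sets borel" by (simp add: N_def)
  have y[measurable]: "y \<in> borel_measurable M"
    using distributed_measurable[OF assms(3)] by simp
  have law: "distr M borel y = N"
    using distributed_distr_eq_density[OF assms(3)] by (simp add: N_def cong: distr_cong)
  have prob_N: "prob_space N"
    unfolding law[symmetric] by (rule M.prob_space_distr) simp
  interpret N: prob_space N by (rule prob_N)
  have integrable_y: "integrable M (\<lambda>\<omega>. u (y \<omega>)) \<longleftrightarrow> integrable N u"
    and integral_y: "(\<integral>\<omega>. u (y \<omega>) \<partial>M) = (\<integral>x. u x \<partial>N)"
    if "u \<in> borel_measurable borel" for u :: "real^'n \<Rightarrow> real"
    unfolding law[symmetric] using that by (simp_all add: integrable_distr_eq integral_distr)
  have nn_integral_y: "(\<integral>\<^sup>+\<omega>. u (y \<omega>) \<partial>M) = (\<integral>\<^sup>+x. u x \<partial>N)"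
    if "u \<in> borel_measurable borel" for u :: "real^'n \<Rightarrow> ennreal"
    unfolding law[symmetric] using that by (simp add: nn_integral_distr)

  obtain D :: "real^'n \<Rightarrow> ((real^'n) \<Rightarrow>\<^sub>L (real^'n))" where
    D: "\<And>x. x \<notin> E \<Longrightarrow> (muhat has_derivative blinfun_apply (D x)) (at x)"
    and D_cont: "continuous_on (- E) D"
    using assms(5) unfolding continuously_differentiable_on_def by auto
  have g_eq: "g i x = (if x \<in> E then 0 else D x (axis i 1) $ i)" for i x
  proof (cases "x \<in> E")
    case False
    have "(muhat has_derivative blinfun_apply (D x)) (at (x + 0 *\<^sub>R axis i 1))"
      using D[OF False] by simp
    from DERIV_imp_deriv[OF has_real_derivative_along_axis[OF this, of i]] False
    show ?thesis by (simp add: g_def off_def partial_deriv_def)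
  qed (simp add: g_def off_def)
  have Dg_cont: "continuous_on (- E) (\<lambda>x. D x (axis i 1) $ i)" for i
    by (intro continuous_intros D_cont)
  have muhat_cont: "continuous_on (- E) muhat"
    using D by (auto intro!: continuous_at_imp_continuous_on has_derivative_continuous)
  have E[measurable]: "E \<in> sets borel" using \<open>closed E\<close> by simp
  have g_meas[measurable]: "g i \<in> borel_measurable borel" for i
    unfolding g_eq[abs_def] using Dg_cont E by (intro borel_measurable_continuous_on_if) auto
  have off_meas[measurable]: "off E muhat \<in> borel_measurable borel"
    unfolding off_def[abs_def] using muhat_cont E by (intro borel_measurable_continuous_on_if) auto
  have f_meas[measurable]: "f i \<in> borel_measurable borel" for i
    unfolding f_def[abs_def] by measurable

  have line: "AE x in lborel.
      (\<forall>s. ((\<lambda>s. f i (replace_coord i x s)) has_real_derivative g i (replace_coord i x s)) (at s)) \<and>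
      continuous_on UNIV (\<lambda>s. g i (replace_coord i x s))" for i
    using AE_line_avoids[OF assms(7), of i]
  proof eventually_elim
    case (elim x)
    then have avoid: "replace_coord i x s \<notin> E" for s by (simp add: replace_coord_def)
    have "((\<lambda>s. muhat (replace_coord i x s) $ i) has_real_derivative D (replace_coord i x s) (axis i 1) $ i) (at s)" for s
      using has_real_derivative_along_axis D[OF avoid[of s]] unfolding replace_coord_eq by blast
    moreover have "continuous_on UNIV (\<lambda>s. D (replace_coord i x s) (axis i 1) $ i)"
      by (rule continuous_on_compose2[OF Dg_cont])
         (use avoid in \<open>auto simp: replace_coord_def intro!: continuous_intros\<close>)
    ultimately show ?case using avoid by (simp add: f_def g_eq off_def)
  qed

  have norm_sq: "integrable N (\<lambda>x. (norm (off E muhat x))\<^sup>2)"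
    using assms(6) by (subst integrable_y[symmetric]) simp_all
  have f_sq: "integrable N (\<lambda>x. (f i x)\<^sup>2)" for i
  proof (rule Bochner_Integration.integrable_bound[OF norm_sq])
    have "(f i x)\<^sup>2 \<le> (norm (off E muhat x))\<^sup>2" for x
      unfolding f_def using component_le_norm_cart[of "off E muhat x" i]
      by (subst abs_le_square_iff[symmetric]) simp
    then show "AE x in N. norm ((f i x)\<^sup>2) \<le> norm ((norm (off E muhat x))\<^sup>2)"
      by (intro AE_I2) simp
  qed simp
  have f_int: "integrable N (f i)" for i
    by (rule N.square_integrable_imp_integrable[OF _ f_sq]) measurable
  have marginal: "distr N borel (\<lambda>x. x $ i) = normal_law (\<mu> $ i) \<sigma>" for i
    using distr_isotropic_normal_nth[OF \<sigma> prob_N[unfolded N_def]] by (simp add: N_def)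
  have moment: "integrable N (\<lambda>x. (x $ i - \<mu> $ i) ^ k)" for i k
  proof -
    have "integrable (normal_law (\<mu> $ i) \<sigma>) (\<lambda>s. (s - \<mu> $ i) ^ k)"
      using integrable_normal_moment[OF \<sigma>] by (simp add: integrable_real_density)
    then show ?thesis unfolding marginal[symmetric] by (simp add: integrable_distr_eq)
  qed
  have centred: "(\<integral>x. x $ i - \<mu> $ i \<partial>N) = 0" for i
  proof -
    have "(\<integral>x. x $ i - \<mu> $ i \<partial>N) = (\<integral>s. s - \<mu> $ i \<partial>distr N borel (\<lambda>x. x $ i))"
      by (simp add: integral_distr)
    also have "\<dots> = (\<integral>s. normal_density (\<mu> $ i) \<sigma> s * (s - \<mu> $ i) \<partial>lborel)"
      unfolding marginal by (simp add: integral_real_density)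
    also have "\<dots> = 0" using integral_normal_moment_odd[OF \<sigma>, of "\<mu> $ i" 0] by simp
    finally show ?thesis .
  qed
  have coord_int: "integrable N (\<lambda>x. x $ i - \<mu> $ i)" for i using moment[of i 1] by simp
  have mean: "(\<integral>x. x $ i \<partial>N) = \<mu> $ i" for i
  proof -
    have "integrable N (\<lambda>x. x $ i)"
      using Bochner_Integration.integrable_add[OF coord_int, of "\<lambda>_. \<mu> $ i" i] by simp
    then show ?thesis using centred[of i] by (simp add: N.prob_space)
  qed
  \<comment> \<open>A product of two square integrable functions, by \<open>\<bar>a b\<bar> \<le> a\<^sup>2 + b\<^sup>2\<close>.\<close>
  have prod_int: "integrable N (\<lambda>x. f i x * (x $ i - \<mu> $ i))" for i
  proof (rule Bochner_Integration.integrable_bound[OF Bochner_Integration.integrable_add[OF f_sq[of i] moment[of i 2]]])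
    have "\<bar>a * b\<bar> \<le> \<bar>a\<^sup>2 + b\<^sup>2\<bar>" for a b :: real
    proof -
      have "2 * \<bar>a * b\<bar> \<le> a\<^sup>2 + b\<^sup>2"
        using sum_squares_bound[of "\<bar>a\<bar>" "\<bar>b\<bar>"] by (simp add: abs_mult mult.assoc)
      moreover have "0 \<le> \<bar>a * b\<bar>" by simp
      ultimately show ?thesis by linarith
    qed
    then show "AE x in N. norm (f i x * (x $ i - \<mu> $ i)) \<le> norm ((f i x)\<^sup>2 + (x $ i - \<mu> $ i)\<^sup>2)"
      by (auto intro!: always_eventually)
  qed simp

  \<comment> \<open>Either alternative makes the expectation of each partial derivative exist in \<open>[-\<infinity>, \<infinity>]\<close>.\<close>
  have quasi: "(\<integral>\<^sup>+x. ennreal (g i x) \<partial>N) < \<infinity> \<or> (\<integral>\<^sup>+x. ennreal (- g i x) \<partial>N) < \<infinity>" for i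
    using assms(8)
  proof
    assume *: "(\<Sum>i\<in>UNIV. \<integral>\<^sup>+\<omega>. ennreal \<bar>off E (partial_deriv i (\<lambda>x. muhat x $ i)) (y \<omega>)\<bar> \<partial>M) < \<infinity>"
    have "(\<integral>\<^sup>+x. ennreal (g i x) \<partial>N) \<le> (\<integral>\<^sup>+x. ennreal \<bar>g i x\<bar> \<partial>N)"
      by (intro nn_integral_mono ennreal_leI) simp
    also have "\<dots> = (\<integral>\<^sup>+\<omega>. ennreal \<bar>g i (y \<omega>)\<bar> \<partial>M)"
      by (rule nn_integral_y[symmetric]) simp
    also have "\<dots> \<le> (\<Sum>i\<in>UNIV. \<integral>\<^sup>+\<omega>. ennreal \<bar>g i (y \<omega>)\<bar> \<partial>M)"
      by (rule member_le_sum) auto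
    also have "\<dots> < \<infinity>" using * by (simp add: g_def)
    finally show ?thesis ..
  next
    assume "(AE x in lborel. x \<notin> E \<longrightarrow> divergence muhat x \<ge> 0) \<and>
         (\<forall>i. expectation_exists M (\<lambda>\<omega>. off E (partial_deriv i (\<lambda>x. muhat x $ i)) (y \<omega>)))"
    then have "expectation_exists M (\<lambda>\<omega>. g i (y \<omega>))" by (simp add: g_def)
    then show ?thesis
      using nn_integral_y[of "\<lambda>x. ennreal (g i x)"] nn_integral_y[of "\<lambda>x. ennreal (- g i x)"]
      by (simp add: expectation_exists_def)
  qed
  have stein: "integrable N (g i) \<and> (\<integral>x. g i x \<partial>N) = (\<integral>x. f i x * (x $ i - \<mu> $ i) / \<sigma>\<^sup>2 \<partial>N)" for i
    unfolding N_def
    by (rule stein_identity_coordinate_two_sided[OF \<sigma> _ _ _ line])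
       (use prob_N f_int prod_int quasi in \<open>simp_all add: N_def\<close>)
  have cov: "covariance M (\<lambda>\<omega>. off E muhat (y \<omega>) $ i) (\<lambda>\<omega>. y \<omega> $ i) = \<sigma>\<^sup>2 * (\<integral>x. g i x \<partial>N)" for i
  proof -
    define c where "c = (\<integral>x. f i x \<partial>N)"
    have "covariance M (\<lambda>\<omega>. off E muhat (y \<omega>) $ i) (\<lambda>\<omega>. y \<omega> $ i)
        = (\<integral>\<omega>. (f i (y \<omega>) - c) * (y \<omega> $ i - \<mu> $ i) \<partial>M)"
      using integral_y[OF f_meas, of i] integral_y[of "\<lambda>x. x $ i"]
      by (simp add: covariance_def f_def[symmetric] c_def mean)
    also have "\<dots> = (\<integral>x. (f i x - c) * (x $ i - \<mu> $ i) \<partial>N)"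
      by (rule integral_y) simp
    also have "\<dots> = (\<integral>x. f i x * (x $ i - \<mu> $ i) - c * (x $ i - \<mu> $ i) \<partial>N)"
      by (simp add: left_diff_distrib)
    also have "\<dots> = (\<integral>x. f i x * (x $ i - \<mu> $ i) \<partial>N)"
      by (subst Bochner_Integration.integral_diff) (use prod_int coord_int centred in simp_all)
    also have "\<dots> = \<sigma>\<^sup>2 * (\<integral>x. g i x \<partial>N)" using \<sigma> stein by simp
    finally show ?thesis .
  qed
  have g_M: "integrable M (\<lambda>\<omega>. g i (y \<omega>))" "(\<integral>\<omega>. g i (y \<omega>) \<partial>M) = (\<integral>x. g i x \<partial>N)" for i
    using integrable_y[OF g_meas] integral_y[OF g_meas] stein by auto
  have div: "off E (divergence muhat) x = (\<Sum>i\<in>UNIV. g i x)" for x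
    by (simp add: off_def g_def divergence_def)
  show ?thesis
    unfolding div g_def[symmetric] cov
    using g_M \<sigma> by (simp add: sum_distrib_left[symmetric])
qed

end
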